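(* Let $G$ be a simple connected graph and let $e \ge 1$ be an integer. Suppose $G$ admits a perfect $e$-error-correcting code $D \subseteq V(G)$. Then: (i) if $e = 1$, then for every integer $k \ge 1$ there exists a quasi-perfect $1$-error-correcting code in the Cartesian product $G \square P_{3k}$ and in $G \square C_{3k}$; (ii) if $e \ge 2$, then there exists a quasi-perfect $e$-error-correcting code in $G \square P_3$ and in $G \square C_3$.
   Context: All graphs are simple and connected; $d(x,y)$ is the shortest-path distance. $P_n$ is the path on $n$ vertices and, for $n\ge 3$, $C_n$ is the cycle on $n$ vertices. The Cartesian product $G\square H$ has vertex set $V(G)\times V(H)$, with $(g_1,h_1)$ adjacent to $(g_2,h_2)$ iff either $h_1=h_2$ and $g_1g_2\in E(G)$, or $g_1=g_2$ and $h_1h_2\in E(H)$. A code is a subset $D\subseteq V(G)$. $D$ is $t$-error-correcting if any two distinct codewords are at distance at least $2t+1$. The covering radius of $D$ is the smallest $r$ such that every vertex is at distance at most $r$ from some codeword. $D$ is $t$-perfect (a perfect $t$-error-correcting code) if it is $t$-error-correcting with covering radius $t$, and $t$-quasi-perfect (a quasi-perfect $t$-error-correcting code) if it is $t$-error-correcting with covering radius $t+1$. *)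

theory Defs
  imports "Graph_Theory.Graph_Theory"
begin

text \<open>
  A simple graph is a symmetric loop-free pair digraph (\<^locale>\<open>pair_bidirected_digraph\<close>): an
  undirected edge \<open>uv\<close> is the pair of arcs \<open>(u,v)\<close>, \<open>(v,u)\<close>. Vertex sets may be infinite.
\<close>

definition gdist :: "'a pair_pre_digraph \<Rightarrow> 'a \<Rightarrow> 'a \<Rightarrow> ereal" where
  "gdist G u v = wf_digraph.\<mu> (with_proj G) (\<lambda>_. 1) u v"

definition path_graph :: "nat \<Rightarrow> nat pair_pre_digraph" where
  "path_graph n = \<lparr> pverts = {..<n},
     parcs = {(i, j). i < n \<and> j < n \<and> (j = i + 1 \<or> i = j + 1)} \<rparr>"

text \<open>Only meaningful for \<open>n \<ge> 3\<close>; for \<open>n = 1\<close> it has a loop.\<close>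

definition cycle_graph :: "nat \<Rightarrow> nat pair_pre_digraph" where
  "cycle_graph n = \<lparr> pverts = {..<n},
     parcs = {(i, j). i < n \<and> j < n \<and> (j = (i + 1) mod n \<or> i = (j + 1) mod n)} \<rparr>"

definition cartesian_product ::
  "'a pair_pre_digraph \<Rightarrow> 'b pair_pre_digraph \<Rightarrow> ('a \<times> 'b) pair_pre_digraph" (infixr \<open>\<box>\<close> 70)
where
  "G \<box> H = \<lparr> pverts = pverts G \<times> pverts H,
     parcs = {((g1, h1), (g2, h2)).
       (h1 = h2 \<and> h1 \<in> pverts H \<and> (g1, g2) \<in> parcs G) \<or>
       (g1 = g2 \<and> g1 \<in> pverts G \<and> (h1, h2) \<in> parcs H)} \<rparr>"

definition error_correcting :: "'a pair_pre_digraph \<Rightarrow> nat \<Rightarrow> 'a set \<Rightarrow> bool" where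
  "error_correcting G t D \<longleftrightarrow> D \<subseteq> pverts G \<and>
     (\<forall>x\<in>D. \<forall>y\<in>D. x \<noteq> y \<longrightarrow> ereal (real (2 * t + 1)) \<le> gdist G x y)"

definition covers_within :: "'a pair_pre_digraph \<Rightarrow> 'a set \<Rightarrow> nat \<Rightarrow> bool" where
  "covers_within G D r \<longleftrightarrow> (\<forall>v\<in>pverts G. \<exists>c\<in>D. gdist G v c \<le> ereal (real r))"

text \<open>
  The covering radius is a relation because an infinite graph may have codes
  (and every nonempty graph has the empty code) for which no radius exists.
\<close>

definition has_covering_radius :: "'a pair_pre_digraph \<Rightarrow> 'a set \<Rightarrow> nat \<Rightarrow> bool" where
  "has_covering_radius G D r \<longleftrightarrow>
     covers_within G D r \<and> (\<forall>s. covers_within G D s \<longrightarrow> r \<le> s)"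

definition perfect_code :: "'a pair_pre_digraph \<Rightarrow> nat \<Rightarrow> 'a set \<Rightarrow> bool" where
  "perfect_code G t D \<longleftrightarrow> error_correcting G t D \<and> has_covering_radius G D t"

definition quasi_perfect_code :: "'a pair_pre_digraph \<Rightarrow> nat \<Rightarrow> 'a set \<Rightarrow> bool" where
  "quasi_perfect_code G t D \<longleftrightarrow> error_correcting G t D \<and> has_covering_radius G D (t + 1)"

lemma pair_bidirected_digraph_path_graph: "pair_bidirected_digraph (path_graph n)"
  by unfold_locales (auto simp: path_graph_def symmetric_def sym_def)

lemma pair_bidirected_digraph_cycle_graph:
  assumes "n \<ge> 3"
  shows "pair_bidirected_digraph (cycle_graph n)"
proof -
  have ne: "(i + 1) mod n \<noteq> i" if "i < n" for i
    using that assms by (cases "i + 1 = n") auto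
  show ?thesis
  proof unfold_locales
    fix a assume "a \<in> parcs (cycle_graph n)"
    then obtain i j where "a = (i, j)" "i < n" "j < n" "j = (i + 1) mod n \<or> i = (j + 1) mod n"
      unfolding cycle_graph_def by auto
    then show "fst a \<in> pverts (cycle_graph n)" "snd a \<in> pverts (cycle_graph n)" "fst a \<noteq> snd a"
      using ne[of i] ne[of j] unfolding cycle_graph_def by (simp, simp, metis fst_conv snd_conv)
  next
    show "symmetric (with_proj (cycle_graph n))"
      unfolding symmetric_def with_proj_simps sym_def cycle_graph_def by simp blast
  qed
qed

lemma pair_bidirected_digraph_cartesian_product:
  assumes "pair_bidirected_digraph G" "pair_bidirected_digraph H"
  shows "pair_bidirected_digraph (G \<box> H)"
proof -
  interpret G: pair_bidirected_digraph G by fact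
  interpret H: pair_bidirected_digraph H by fact
  show ?thesis
  proof unfold_locales
    fix a assume "a \<in> parcs (G \<box> H)"
    then obtain g h g' h' where a: "a = ((g, h), (g', h'))"
      "h = h' \<and> h \<in> pverts H \<and> (g, g') \<in> parcs G \<or> g = g' \<and> g \<in> pverts G \<and> (h, h') \<in> parcs H"
      unfolding cartesian_product_def by auto
    then show "fst a \<in> pverts (G \<box> H)" "snd a \<in> pverts (G \<box> H)" "fst a \<noteq> snd a"
      using G.wellformed'[of g g'] H.wellformed'[of h h']
        G.pair_no_loops[of "(g, g')"] H.pair_no_loops[of "(h, h')"]
      by (auto simp: cartesian_product_def)
  next
    show "symmetric (with_proj (G \<box> H))"
      unfolding symmetric_def with_proj_simps cartesian_product_def
      by (rule symI) (clarsimp, metis G.arcs_symmetric H.arcs_symmetric)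
  qed
qed

end

theory Submission
  imports Defs
begin

text \<open>
  Distances in a Cartesian product add up. Hence, if \<open>S\<close> is a code in \<open>H\<close> of covering radius 1
  whose minimum distance is at least \<open>2e + 1\<close>, then \<open>D \<times> S\<close> is \<open>e\<close>-error-correcting in \<open>G \<box> H\<close>
  with covering radius \<open>e + 1\<close>. On a path or cycle with \<open>3k\<close> vertices take the vertices congruent
  to 1 modulo 3: their minimum distance is 3, and for \<open>k = 1\<close> there is only one of them, so that
  every \<open>e\<close> is allowed.
\<close>

section \<open>Distance as the least length of a walk\<close>

text \<open>\<open>parcs G ^^ 0\<close> is the identity on the whole type, whereas an awalk must
  start at a vertex; hence the conjunct \<open>u \<in> pverts G\<close>.\<close>

lemma awalk_iff_relpow:
  assumes "pair_wf_digraph G"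
  shows "(\<exists>p. pre_digraph.awalk (with_proj G) u p v \<and> length p = n) \<longleftrightarrow>
    u \<in> pverts G \<and> (u, v) \<in> parcs G ^^ n"
proof -
  interpret pair_wf_digraph G by fact
  show ?thesis
  proof (induction n arbitrary: u)
    case 0
    show ?case by (auto simp: awalk_Nil_iff)
  next
    case (Suc n)
    have "(\<exists>p. awalk u p v \<and> length p = Suc n) \<longleftrightarrow>
      (\<exists>w. (u, w) \<in> parcs G \<and> (\<exists>p. awalk w p v \<and> length p = n))"
      (is "?lhs \<longleftrightarrow> ?rhs")
    proof
      assume ?lhs
      then obtain a q where "awalk u (a # q) v" "length q = n" by (auto simp: length_Suc_conv)
      then show ?rhs by (cases a) (auto simp: awalk_Cons_iff)
    next
      assume ?rhs
      then obtain w q where "awalk u ((u, w) # q) v" "length q = n" by (auto simp: awalk_Cons_iff)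
      then show ?lhs by (intro exI[of _ "(u, w) # q"]) simp
    qed
    also have "\<dots> \<longleftrightarrow> u \<in> pverts G \<and> (u, v) \<in> parcs G ^^ Suc n"
      unfolding Suc using wellformed' by (metis relpow_Suc_I2 relpow_Suc_E2)
    finally show ?case .
  qed
qed

text \<open>With unit weights the cost of a walk is its length. If no walk exists, the infimum runs
  over the empty set and is \<infinity>.\<close>

lemma gdist_eq_INF_relpow:
  assumes "pair_wf_digraph G" and "u \<in> pverts G"
  shows "gdist G u v = (INF n \<in> {n. (u, v) \<in> parcs G ^^ n}. ereal (real n))"
proof -
  interpret pair_wf_digraph G by fact
  have cost: "awalk_cost (\<lambda>_. 1) p = real (length p)" for p
    by (induction p) auto
  have "{n. (u, v) \<in> parcs G ^^ n} = length ` {p. awalk u p v}"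
    using awalk_iff_relpow[OF assms(1), of u v] assms(2) by (auto simp: image_iff) metis
  then show ?thesis
    unfolding gdist_def \<mu>_def cost by (simp add: image_image)
qed

lemma le_gdist_iff:
  assumes "pair_wf_digraph G" and "u \<in> pverts G"
  shows "ereal (real n) \<le> gdist G u v \<longleftrightarrow> (\<forall>m. (u, v) \<in> parcs G ^^ m \<longrightarrow> n \<le> m)"
  unfolding gdist_eq_INF_relpow[OF assms] by (auto simp: le_INF_iff)

lemma gdist_le_iff:
  assumes "pair_wf_digraph G" and "u \<in> pverts G"
  shows "gdist G u v \<le> ereal (real n) \<longleftrightarrow> (\<exists>m\<le>n. (u, v) \<in> parcs G ^^ m)"
proof
  assume "gdist G u v \<le> ereal (real n)"
  \<comment> \<open>Lengths are integers: a distance below \<open>Suc n\<close> refutes the lower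
    bound \<open>Suc n\<close>, and this yields an actual walk of length at most
    \<open>n\<close>.\<close>
  also have "ereal (real n) < ereal (real (Suc n))" by simp
  finally have "\<not> ereal (real (Suc n)) \<le> gdist G u v" by simp
  then show "\<exists>m\<le>n. (u, v) \<in> parcs G ^^ m"
    unfolding le_gdist_iff[OF assms] by (auto simp: not_less_eq_eq)
next
  assume "\<exists>m\<le>n. (u, v) \<in> parcs G ^^ m"
  then show "gdist G u v \<le> ereal (real n)"
    unfolding gdist_eq_INF_relpow[OF assms] by (auto intro: INF_lower2)
qed

section \<open>Powers of the arc relation and walks in a Cartesian product\<close>

lemma relpow_mono:
  fixes R S :: "'a rel"
  assumes "R \<subseteq> S"
  shows "R ^^ n \<subseteq> S ^^ n"
  by (induction n) (use assms in \<open>auto intro: relcomp_mono\<close>)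

text \<open>Each step in the product moves exactly one coordinate; \<open>i\<close> and
  \<open>j\<close> count the steps spent in each factor.\<close>

lemma relpow_cartesian_productD:
  assumes "((g, h), (g', h')) \<in> parcs (G \<box> H) ^^ n"
  obtains i j where "n = i + j" "(g, g') \<in> parcs G ^^ i" "(h, h') \<in> parcs H ^^ j"
proof -
  have "\<exists>i j. n = i + j \<and> (g, g') \<in> parcs G ^^ i \<and> (h, h') \<in> parcs H ^^ j"
    using assms
  proof (induction n arbitrary: g' h')
    case 0
    then show ?case by auto
  next
    case (Suc n)
    then obtain a b where "((g, h), (a, b)) \<in> parcs (G \<box> H) ^^ n"
      and last: "((a, b), (g', h')) \<in> parcs (G \<box> H)"
      by auto
    with Suc.IH obtain i j where ij: "n = i + j" "(g, a) \<in> parcs G ^^ i" "(h, b) \<in> parcs H ^^ j"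
      by blast
    from last consider "b = h'" "(a, g') \<in> parcs G" | "a = g'" "(b, h') \<in> parcs H"
      by (auto simp: cartesian_product_def)
    then show ?case
    proof cases
      case 1
      then show ?thesis using ij by (intro exI[of _ "Suc i"] exI[of _ j]) auto
    next
      case 2
      then show ?thesis using ij by (intro exI[of _ i] exI[of _ "Suc j"]) auto
    qed
  qed
  then show thesis using that by blast
qed

text \<open>Walk first inside the copy of \<open>G\<close> at \<open>h\<close>, then inside the copy
  of \<open>H\<close> at \<open>g'\<close>.\<close>

lemma relpow_cartesian_productI:
  assumes "pair_wf_digraph G" and "g \<in> pverts G" and "h \<in> pverts H"
    and "(g, g') \<in> parcs G ^^ i" and "(h, h') \<in> parcs H ^^ j"
  shows "((g, h), (g', h')) \<in> parcs (G \<box> H) ^^ (i + j)"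
proof -
  interpret pair_wf_digraph G by fact
  have left: "((g, h), (g', h)) \<in> parcs (G \<box> H) ^^ i"
    using assms(4)
    by (induction i arbitrary: g') (use assms(3) in \<open>force simp: cartesian_product_def\<close>)+
  have "g' \<in> pverts G"
    using assms(2,4) by (cases i) (auto dest: wellformed')
  then have "((g', h), (g', h')) \<in> parcs (G \<box> H) ^^ j"
    using assms(5) by (induction j arbitrary: h') (force simp: cartesian_product_def)+
  with left show ?thesis by (rule relpow_trans)
qed

section \<open>Codes in a Cartesian product\<close>

lemma pair_wf_digraph_cartesian_product:
  assumes "pair_wf_digraph G" and "pair_wf_digraph H"
  shows "pair_wf_digraph (G \<box> H)"
proof -
  interpret G: pair_wf_digraph G by fact
  interpret H: pair_wf_digraph H by fact
  show ?thesis
    by unfold_locales (auto simp: cartesian_product_def dest: G.wellformed' H.wellformed')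
qed

lemma pverts_cartesian_product [simp]: "pverts (G \<box> H) = pverts G \<times> pverts H"
  by (simp add: cartesian_product_def)

text \<open>Distinct pairs differ in some coordinate, and the projection of a walk to that
  coordinate already has at least \<open>2 * t + 1\<close> steps.\<close>

lemma error_correcting_cartesian_product:
  assumes G: "pair_wf_digraph G" and H: "pair_wf_digraph H"
    and D: "error_correcting G t D" and S: "error_correcting H t S"
  shows "error_correcting (G \<box> H) t (D \<times> S)"
  unfolding error_correcting_def
proof (intro conjI ballI impI)
  show "D \<times> S \<subseteq> pverts (G \<box> H)"
    using D S by (auto simp: error_correcting_def)
  fix x y assume x: "x \<in> D \<times> S" and y: "y \<in> D \<times> S" and "x \<noteq> y"
  obtain g h g' h' where xy: "x = (g, h)" "y = (g', h')" by fastforce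
  have mem: "g \<in> D" "g' \<in> D" "h \<in> S" "h' \<in> S" "g \<in> pverts G" "h \<in> pverts H"
    using x y xy D S by (auto simp: error_correcting_def)
  have gG: "2 * t + 1 \<le> m" if "g \<noteq> g'" "(g, g') \<in> parcs G ^^ m" for m
    using D that mem le_gdist_iff[OF G, of g "2 * t + 1" g'] unfolding error_correcting_def by blast
  have hH: "2 * t + 1 \<le> m" if "h \<noteq> h'" "(h, h') \<in> parcs H ^^ m" for m
    using S that mem le_gdist_iff[OF H, of h "2 * t + 1" h'] unfolding error_correcting_def by blast
  have "2 * t + 1 \<le> m" if m: "((g, h), (g', h')) \<in> parcs (G \<box> H) ^^ m" for m
  proof -
    from m obtain i j where "m = i + j" "(g, g') \<in> parcs G ^^ i" "(h, h') \<in> parcs H ^^ j"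
      by (rule relpow_cartesian_productD)
    moreover have "g \<noteq> g' \<or> h \<noteq> h'" using \<open>x \<noteq> y\<close> xy by simp
    ultimately show ?thesis using gG hH by (metis trans_le_add1 trans_le_add2)
  qed
  then show "ereal (real (2 * t + 1)) \<le> gdist (G \<box> H) x y"
    using le_gdist_iff[OF pair_wf_digraph_cartesian_product[OF G H], of x "2 * t + 1" y] mem xy
    by auto
qed

text \<open>Minimality of the radius means that \<open>r - 1\<close> fails to cover some vertex; for
  \<open>r = 0\<close> any vertex will do.\<close>

lemma has_covering_radius_far_vertex:
  assumes G: "pair_wf_digraph G" and D: "has_covering_radius G D r" and "pverts G \<noteq> {}"
  obtains v where "v \<in> pverts G" and "\<And>c n. c \<in> D \<Longrightarrow> (v, c) \<in> parcs G ^^ n \<Longrightarrow> r \<le> n"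
proof (cases r)
  case 0
  then show thesis using that assms(3) by auto
next
  case (Suc s)
  then have "\<not> covers_within G D s"
    using D unfolding has_covering_radius_def by fastforce
  then obtain v where "v \<in> pverts G" "\<forall>c\<in>D. \<not> (\<exists>n\<le>s. (v, c) \<in> parcs G ^^ n)"
    unfolding covers_within_def using gdist_le_iff[OF G] by blast
  then show thesis using that Suc by (metis not_less_eq_eq)
qed

text \<open>Covering walks in the two factors combine to one of length at most \<open>r + s\<close>.
  Conversely, a pair of vertices far from \<open>D\<close> and from \<open>S\<close> is at distance
  at least \<open>r + s\<close> from \<open>D \<times> S\<close>.\<close>

lemma has_covering_radius_cartesian_product:
  assumes G: "pair_wf_digraph G" and H: "pair_wf_digraph H"
    and ne: "pverts G \<noteq> {}" "pverts H \<noteq> {}"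
    and D: "has_covering_radius G D r" and S: "has_covering_radius H S s"
  shows "has_covering_radius (G \<box> H) (D \<times> S) (r + s)"
proof -
  note GH = pair_wf_digraph_cartesian_product[OF G H]
  have "covers_within (G \<box> H) (D \<times> S) (r + s)"
    unfolding covers_within_def
  proof
    fix v assume v: "v \<in> pverts (G \<box> H)"
    then obtain g h where gh: "v = (g, h)" "g \<in> pverts G" "h \<in> pverts H" by auto
    obtain c i where "c \<in> D" "i \<le> r" "(g, c) \<in> parcs G ^^ i"
      using D gh(2) gdist_le_iff[OF G gh(2)]
      unfolding has_covering_radius_def covers_within_def by blast
    moreover obtain d j where "d \<in> S" "j \<le> s" "(h, d) \<in> parcs H ^^ j"
      using S gh(3) gdist_le_iff[OF H gh(3)]
      unfolding has_covering_radius_def covers_within_def by blast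
    ultimately have "(c, d) \<in> D \<times> S" "i + j \<le> r + s" "(v, (c, d)) \<in> parcs (G \<box> H) ^^ (i + j)"
      using relpow_cartesian_productI[OF G gh(2,3)] gh(1) by auto
    then show "\<exists>c\<in>D \<times> S. gdist (G \<box> H) v c \<le> ereal (real (r + s))"
      using gdist_le_iff[OF GH v] by blast
  qed
  moreover have "r + s \<le> n" if n: "covers_within (G \<box> H) (D \<times> S) n" for n
  proof -
    obtain g where g: "g \<in> pverts G" "\<And>c n. c \<in> D \<Longrightarrow> (g, c) \<in> parcs G ^^ n \<Longrightarrow> r \<le> n"
      using has_covering_radius_far_vertex[OF G D ne(1)] by metis
    obtain h where h: "h \<in> pverts H" "\<And>c n. c \<in> S \<Longrightarrow> (h, c) \<in> parcs H ^^ n \<Longrightarrow> s \<le> n"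
      using has_covering_radius_far_vertex[OF H S ne(2)] by metis
    have gh: "(g, h) \<in> pverts (G \<box> H)" using g h by simp
    then obtain c d m where cd: "c \<in> D" "d \<in> S" "m \<le> n"
      and m: "((g, h), (c, d)) \<in> parcs (G \<box> H) ^^ m"
      using n gdist_le_iff[OF GH gh] unfolding covers_within_def by blast
    from m obtain i j where "m = i + j" "(g, c) \<in> parcs G ^^ i" "(h, d) \<in> parcs H ^^ j"
      by (rule relpow_cartesian_productD)
    then show ?thesis using cd g(2) h(2) by fastforce
  qed
  ultimately show ?thesis unfolding has_covering_radius_def by blast
qed

lemma quasi_perfect_code_cartesian_product:
  assumes "pair_wf_digraph G" and "pair_wf_digraph H" and "pverts G \<noteq> {}" and "pverts H \<noteq> {}"
    and "perfect_code G t D" and "error_correcting H t S" and "has_covering_radius H S 1"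
  shows "quasi_perfect_code (G \<box> H) t (D \<times> S)"
  using assms error_correcting_cartesian_product has_covering_radius_cartesian_product
  unfolding perfect_code_def quasi_perfect_code_def by blast

section \<open>The code on paths and cycles with \<open>3 * k\<close> vertices\<close>

definition third_vertices :: "nat \<Rightarrow> nat set" where
  "third_vertices k = {i. i < 3 * k \<and> i mod 3 = 1}"

text \<open>This lets both graphs be treated at once: for any \<open>H\<close> between path and
  cycle, separation of codewords is inherited from the cycle and covering from the path.\<close>

lemma parcs_path_graph_subset_cycle_graph: "parcs (path_graph n) \<subseteq> parcs (cycle_graph n)"
  by (auto simp: path_graph_def cycle_graph_def)

text \<open>
  A single step changes the residue modulo 3. Two steps returning to the same residue modulo 3 are a step and its reversal, so they return to
  the same vertex.
\<close>

lemma cycle_graph_walk_between_third_vertices: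
  assumes "x \<in> third_vertices k" and "y \<in> third_vertices k" and "x \<noteq> y"
    and "(x, y) \<in> parcs (cycle_graph (3 * k)) ^^ m"
  shows "3 \<le> m"
proof (rule ccontr)
  let ?E = "parcs (cycle_graph (3 * k))"
  have lt: "x < 3 * k" "y < 3 * k" and mod3: "x mod 3 = 1" "y mod 3 = 1"
    using assms(1,2) by (auto simp: third_vertices_def)
  \<comment> \<open>Since 3 divides \<open>3 * k\<close>, the arc that closes the cycle shifts
    residues modulo 3 like every other arc.\<close>
  have succ: "j mod 3 = (i + 1) mod 3" if "j = (i + 1) mod (3 * k)" for i j
    using that by (simp add: mod_mod_cancel)
  assume "\<not> 3 \<le> m"
  then consider "m = 0" | "m = 1" | "m = 2" by linarith
  then show False
  proof cases
    case 1
    then show ?thesis using assms by simp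
  next
    case 2
    then have "y = (x + 1) mod (3 * k) \<or> x = (y + 1) mod (3 * k)"
      using assms(4) by (auto simp: cycle_graph_def)
    then have "y mod 3 = (x + 1) mod 3 \<or> x mod 3 = (y + 1) mod 3"
      by (metis succ)
    with mod3 show ?thesis by presburger
  next
    case 3
    then obtain z where xz: "(x, z) \<in> ?E" and zy: "(z, y) \<in> ?E"
      using assms(4) by (auto simp: numeral_2_eq_2)
    have inj: "x = y" if "(x + 1) mod (3 * k) = (y + 1) mod (3 * k)"
      using that lt by (auto simp: mod_Suc split: if_splits)
    from xz zy have "z = (x + 1) mod (3 * k) \<or> x = (z + 1) mod (3 * k)"
      and "y = (z + 1) mod (3 * k) \<or> z = (y + 1) mod (3 * k)"
      by (auto simp: cycle_graph_def)
    \<comment> \<open>The first two cases turn back at \<open>z\<close>; the last two keep their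
      direction and shift the residue by 2 modulo 3.\<close>
    then consider "z = (x + 1) mod (3 * k)" "z = (y + 1) mod (3 * k)"
      | "x = (z + 1) mod (3 * k)" "y = (z + 1) mod (3 * k)"
      | "z = (x + 1) mod (3 * k)" "y = (z + 1) mod (3 * k)"
      | "x = (z + 1) mod (3 * k)" "z = (y + 1) mod (3 * k)"
      by blast
    then show ?thesis
    proof cases
      case 1
      then show ?thesis using inj assms(3) by simp
    next
      case 2
      then show ?thesis using assms(3) by simp
    next
      case 3
      then have "z mod 3 = (x + 1) mod 3" "y mod 3 = (z + 1) mod 3" by (metis succ)+
      with mod3 show ?thesis by presburger
    next
      case 4
      then have "x mod 3 = (z + 1) mod 3" "z mod 3 = (y + 1) mod 3" by (metis succ)+
      with mod3 show ?thesis by presburger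
    qed
  qed
qed

lemma error_correcting_third_vertices:
  assumes H: "pair_wf_digraph H" "pverts H = {..<3 * k}"
    and sub: "parcs H \<subseteq> parcs (cycle_graph (3 * k))" and t: "t = 1 \<or> k = 1"
  shows "error_correcting H t (third_vertices k)"
  unfolding error_correcting_def
proof (intro conjI ballI impI)
  show subset: "third_vertices k \<subseteq> pverts H"
    by (auto simp: third_vertices_def H(2))
  fix x y assume xy: "x \<in> third_vertices k" "y \<in> third_vertices k" "x \<noteq> y"
  \<comment> \<open>For \<open>k = 1\<close> the only codeword is 1, so two distinct codewords force
    \<open>t = 1\<close>.\<close>
  then have "k \<noteq> 1"
    by (auto simp: third_vertices_def)
  with t have t1: "t = 1" by simp
  have "3 \<le> m" if "(x, y) \<in> parcs H ^^ m" for m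
    using cycle_graph_walk_between_third_vertices[OF xy] relpow_mono[OF sub] that by blast
  then show "ereal (real (2 * t + 1)) \<le> gdist H x y"
    using le_gdist_iff[OF H(1), of x 3 y] xy subset t1 by auto
qed

lemma has_covering_radius_third_vertices:
  assumes H: "pair_wf_digraph H" "pverts H = {..<3 * k}" and "1 \<le> k"
    and sup: "parcs (path_graph (3 * k)) \<subseteq> parcs H"
  shows "has_covering_radius H (third_vertices k) 1"
proof -
  have "\<exists>c\<in>third_vertices k. gdist H v c \<le> ereal (real 1)" if v: "v \<in> pverts H" for v
  proof -
    \<comment> \<open>The middle of the block of three consecutive vertices that contains
      \<open>v\<close>.\<close>
    define c where "c = 3 * (v div 3) + 1"
    have "v < 3 * k" using v H(2) by simp
    then have "v div 3 < k" by (simp add: less_mult_imp_div_less mult.commute)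
    then have c: "c < 3 * k" "c mod 3 = 1" unfolding c_def by simp_all
    have "v = c \<or> c = v + 1 \<or> v = c + 1" unfolding c_def by presburger
    then have "v = c \<or> (v, c) \<in> parcs H"
      using sup \<open>v < 3 * k\<close> c(1) by (auto simp: path_graph_def)
    then have "\<exists>m\<le>1. (v, c) \<in> parcs H ^^ m"
      by (metis le_refl relpow_0_I relpow_1 zero_le)
    then have "gdist H v c \<le> ereal (real 1)"
      using gdist_le_iff[OF H(1) v] by blast
    then show ?thesis
      using c by (auto simp: third_vertices_def)
  qed
  moreover have "1 \<le> n" if n: "covers_within H (third_vertices k) n" for n
  proof (rule ccontr)
    assume "\<not> 1 \<le> n"
    then have "n = 0" by simp
    \<comment> \<open>Vertex 0 is not a codeword, so radius 0 cannot suffice.\<close>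
    have zero: "0 \<in> pverts H" using H(2) assms(3) by simp
    then obtain c where "c \<in> third_vertices k" "gdist H 0 c \<le> ereal (real 0)"
      using n \<open>n = 0\<close> unfolding covers_within_def by blast
    then have "0 \<in> third_vertices k"
      unfolding gdist_le_iff[OF H(1) zero] by simp
    then show False by (simp add: third_vertices_def)
  qed
  ultimately show ?thesis
    unfolding has_covering_radius_def covers_within_def by blast
qed

lemma quasi_perfect_code_third_vertices:
  assumes G: "pair_wf_digraph G" "pverts G \<noteq> {}" "perfect_code G t D"
    and k: "1 \<le> k" "t = 1 \<or> k = 1"
    and H: "H = path_graph (3 * k) \<or> H = cycle_graph (3 * k)"
  shows "quasi_perfect_code (G \<box> H) t (D \<times> third_vertices k)"
proof -
  have "pair_bidirected_digraph H"
    using H k(1) pair_bidirected_digraph_path_graph pair_bidirected_digraph_cycle_graph by auto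
  then interpret H: pair_bidirected_digraph H .
  have wf: "pair_wf_digraph H" ..
  have verts: "pverts H = {..<3 * k}"
    using H by (auto simp: path_graph_def cycle_graph_def)
  have arcs: "parcs (path_graph (3 * k)) \<subseteq> parcs H" "parcs H \<subseteq> parcs (cycle_graph (3 * k))"
    using H parcs_path_graph_subset_cycle_graph by auto
  have "pverts H \<noteq> {}"
    using verts k(1) by (auto simp: lessThan_empty_iff)
  then show ?thesis
    using quasi_perfect_code_cartesian_product[OF G(1) wf G(2) _ G(3)]
      error_correcting_third_vertices[OF wf verts arcs(2) k(2)]
      has_covering_radius_third_vertices[OF wf verts k(1) arcs(1)] by blast
qed

theorem theorem1:
  fixes G :: "'a pair_pre_digraph" and e :: nat and D :: "'a set"
  assumes "pair_bidirected_digraph G"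
    and "Digraph_Component.connected (with_proj G)"
    and "e \<ge> 1"
    and "perfect_code G e D"
  shows "(e = 1 \<longrightarrow> (\<forall>k\<ge>1.
             (\<exists>C. quasi_perfect_code (G \<box> path_graph (3 * k)) 1 C) \<and>
             (\<exists>C. quasi_perfect_code (G \<box> cycle_graph (3 * k)) 1 C))) \<and>
         (e \<ge> 2 \<longrightarrow>
             (\<exists>C. quasi_perfect_code (G \<box> path_graph 3) e C) \<and>
             (\<exists>C. quasi_perfect_code (G \<box> cycle_graph 3) e C))"
proof -
  interpret G: pair_bidirected_digraph G by fact
  have wf: "pair_wf_digraph G" ..
  \<comment> \<open>Connectedness includes nonemptiness, through
    \<open>strongly_connected\<close>.\<close>
  have ne: "pverts G \<noteq> {}"
    using assms(2) by (auto simp: Digraph_Component.connected_def strongly_connected_def)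
  note code = quasi_perfect_code_third_vertices[OF wf ne assms(4)]
  \<comment> \<open>The instance \<open>k = 1\<close> admits every \<open>e\<close>; it is stated
    separately to turn \<open>3 * 1\<close> into 3.\<close>
  have "quasi_perfect_code (G \<box> path_graph 3) e (D \<times> third_vertices 1)"
    and "quasi_perfect_code (G \<box> cycle_graph 3) e (D \<times> third_vertices 1)"
    using code[of 1] by simp_all
  with code show ?thesis by blast
qed

end
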